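(* Let $\mathcal{W}$ be the class of graph maps $f:A\to B$ in the category $\mathcal{G}$ of finite graphs such that for every subgraph $T\subseteq A$ with $T\cong A_s$, the restriction $f|_T:T\to f(T)$ is an isomorphism and $f(T)\cong B_s$. Then the morphism class $\mathcal{W}$ in $\mathcal{G}$ does not satisfy the 2 out of 6 property.
   Context: Graphs: $\mathcal{G}$ is the category of finite undirected graphs without multiple edges (loops are allowed). A morphism (graph map) is a function on vertices that sends edges to edges. For a graph map $f:A\to B$ and a subgraph $T\subseteq A$, $f(T)$ denotes the image subgraph of $B$ (vertices $f(V(T))$, edges the images of the edges of $T$). Folds and stiff graphs: $\mathrm{N}(v)$ is the set of neighbours of $v$ (containing $v$ iff $v$ is looped). A vertex $v$ of $G$ folds to a vertex $v'\neq v$ of $G$ if $\mathrm{N}(v)\subseteq \mathrm{N}(v')$; the graph map $G\to G-v$ sending $v$ to $v'$ and fixing all other vertices is then called a fold map. A graph is stiff if it has no folds. A stiff subgraph of $G$, denoted $G_s$, is a stiff subgraph that $G$ folds down to by a (possibly empty) sequence of folds; it is unique up to isomorphism. 2 out of 6 property of a class of morphisms: for any composable morphisms $f:A\to B$, $g:B\to C$, $h:C\to D$, if $gf$ and $hg$ are in the class, then so are $f,g,h$ and $hgf$. *)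

theory Defs
  imports "Graph_Theory.Pair_Digraph" "Graph_Theory.Digraph_Component"
begin

text \<open>
  The objects of the category of graphs are the \<open>pair_pseudo_graph\<close>s of the library: finite vertex
  set, and a symmetric arc relation, so that an undirected edge \<open>uv\<close> is the pair of arcs \<open>(u,v)\<close>,
  \<open>(v,u)\<close> and a loop at \<open>v\<close> is \<open>(v,v)\<close>. All vertices are drawn from one type \<open>'a\<close>; when \<open>'a\<close> is
  infinite, every finite graph occurs up to isomorphism.
\<close>

definition graph_map :: "'a pair_pre_digraph \<Rightarrow> 'b pair_pre_digraph \<Rightarrow> ('a \<Rightarrow> 'b) \<Rightarrow> bool" where
  "graph_map A B f \<longleftrightarrow>
     (\<forall>v \<in> pverts A. f v \<in> pverts B) \<and> (\<forall>(u, v) \<in> parcs A. (f u, f v) \<in> parcs B)"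

definition graph_iso :: "'a pair_pre_digraph \<Rightarrow> 'b pair_pre_digraph \<Rightarrow> ('a \<Rightarrow> 'b) \<Rightarrow> bool" where
  "graph_iso A B f \<longleftrightarrow> graph_map A B f \<and>
     (\<exists>g. graph_map B A g \<and> (\<forall>v \<in> pverts A. g (f v) = v) \<and> (\<forall>w \<in> pverts B. f (g w) = w))"

definition isomorphic :: "'a pair_pre_digraph \<Rightarrow> 'b pair_pre_digraph \<Rightarrow> bool" (infix "\<simeq>" 50) where
  "A \<simeq> B \<longleftrightarrow> (\<exists>f. graph_iso A B f)"

text \<open>Subgraphs need not be induced. The library's \<open>subgraph\<close> does not include symmetry of the
  arc relation of \<open>T\<close>, hence the first conjunct.\<close>

definition undirected_subgraph :: "'a pair_pre_digraph \<Rightarrow> 'a pair_pre_digraph \<Rightarrow> bool" where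
  "undirected_subgraph T A \<longleftrightarrow> pair_pseudo_graph T \<and> subgraph (with_proj T) (with_proj A)"

definition image_graph :: "('a \<Rightarrow> 'b) \<Rightarrow> 'a pair_pre_digraph \<Rightarrow> 'b pair_pre_digraph" where
  "image_graph f T = \<lparr> pverts = f ` pverts T, parcs = (\<lambda>(u, v). (f u, f v)) ` parcs T \<rparr>"

definition neighbours :: "'a pair_pre_digraph \<Rightarrow> 'a \<Rightarrow> 'a set" where
  "neighbours G v = {w. (v, w) \<in> parcs G}"

definition folds_to :: "'a pair_pre_digraph \<Rightarrow> 'a \<Rightarrow> 'a \<Rightarrow> bool" where
  "folds_to G v v' \<longleftrightarrow>
     v \<in> pverts G \<and> v' \<in> pverts G \<and> v' \<noteq> v \<and> neighbours G v \<subseteq> neighbours G v'"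

definition delete_vertex :: "'a pair_pre_digraph \<Rightarrow> 'a \<Rightarrow> 'a pair_pre_digraph" where
  "delete_vertex G v =
     \<lparr> pverts = pverts G - {v}, parcs = {(x, y) \<in> parcs G. x \<noteq> v \<and> y \<noteq> v} \<rparr>"

definition fold_step :: "'a pair_pre_digraph \<Rightarrow> 'a pair_pre_digraph \<Rightarrow> bool" where
  "fold_step G H \<longleftrightarrow> (\<exists>v v'. folds_to G v v' \<and> H = delete_vertex G v)"

definition stiff :: "'a pair_pre_digraph \<Rightarrow> bool" where
  "stiff G \<longleftrightarrow> \<not> (\<exists>v v'. folds_to G v v')"

definition stiff_subgraph_of :: "'a pair_pre_digraph \<Rightarrow> 'a pair_pre_digraph \<Rightarrow> bool" where
  "stiff_subgraph_of S G \<longleftrightarrow> stiff S \<and> fold_step\<^sup>*\<^sup>* G S"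

text \<open>The stiff subgraph \<open>G\<^sub>s\<close> is determined only up to isomorphism; being isomorphic to \<open>G\<^sub>s\<close> is
  read as being isomorphic to some stiff subgraph that \<open>G\<close> folds down to.\<close>

definition iso_to_stiff :: "'a pair_pre_digraph \<Rightarrow> 'a pair_pre_digraph \<Rightarrow> bool" where
  "iso_to_stiff T G \<longleftrightarrow> (\<exists>S. stiff_subgraph_of S G \<and> T \<simeq> S)"

text \<open>A class of morphisms is a predicate on domain, codomain and underlying function; the
  properties used here depend only on the values of the function on the vertices of its domain.\<close>

type_synonym 'a morphism_class =
  "'a pair_pre_digraph \<Rightarrow> 'a pair_pre_digraph \<Rightarrow> ('a \<Rightarrow> 'a) \<Rightarrow> bool"

definition graph_morphism :: "'a morphism_class" where
  "graph_morphism A B f \<longleftrightarrow> pair_pseudo_graph A \<and> pair_pseudo_graph B \<and> graph_map A B f"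

definition class_W :: "'a morphism_class" where
  "class_W A B f \<longleftrightarrow> graph_morphism A B f \<and>
     (\<forall>T. undirected_subgraph T A \<and> iso_to_stiff T A \<longrightarrow>
        graph_iso T (image_graph f T) f \<and> iso_to_stiff (image_graph f T) B)"

definition two_out_of_six :: "'a morphism_class \<Rightarrow> bool" where
  "two_out_of_six P \<longleftrightarrow> (\<forall>A B C D f g h.
     graph_morphism A B f \<and> graph_morphism B C g \<and> graph_morphism C D h \<and>
     P A C (g \<circ> f) \<and> P B D (h \<circ> g) \<longrightarrow>
       P A B f \<and> P B C g \<and> P C D h \<and> P A D (h \<circ> g \<circ> f))"

end

theory Submission
  imports Defs
begin

text \<open>
  Let \<open>S\<close> consist of two looped vertices \<open>a\<close>, \<open>b\<close> without an edge between them, and let \<open>C\<close> be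
  \<open>S\<close> with a looped twin \<open>c\<close> of \<open>b\<close> added, adjacent to \<open>b\<close>. Then \<open>S\<close> is stiff, \<open>C\<close> folds to \<open>S\<close>,
  and in \<open>S \<rightarrow> S \<rightarrow> C \<rightarrow> S\<close> (identity, inclusion, fold map) both composites of two consecutive
  maps are in the class. The fold map is not: subgraphs need not be induced, so the two loops at
  \<open>b\<close> and \<open>c\<close> form a copy of \<open>S\<close> in \<open>C\<close>, which is collapsed to one vertex.
\<close>

definition loops :: "'a set \<Rightarrow> 'a pair_pre_digraph" where
  "loops V = \<lparr> pverts = V, parcs = Id_on V \<rparr>"

definition loops_with_edge :: "'a set \<Rightarrow> 'a \<Rightarrow> 'a \<Rightarrow> 'a pair_pre_digraph" where
  "loops_with_edge V b c = \<lparr> pverts = V, parcs = Id_on V \<union> {(b, c), (c, b)} \<rparr>"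

lemma loops_simps [simp]: "pverts (loops V) = V" "parcs (loops V) = Id_on V"
  by (simp_all add: loops_def)

lemma loops_with_edge_simps [simp]:
  "pverts (loops_with_edge V b c) = V"
  "parcs (loops_with_edge V b c) = Id_on V \<union> {(b, c), (c, b)}"
  by (simp_all add: loops_with_edge_def)

lemma pair_pseudo_graphI:
  assumes "finite (pverts G)" "sym (parcs G)" "parcs G \<subseteq> pverts G \<times> pverts G"
  shows "pair_pseudo_graph G"
proof -
  have "finite (parcs G)"
    using assms finite_subset by blast
  then show ?thesis
    using assms by unfold_locales (auto simp: symmetric_def)
qed

lemma pair_pseudo_graph_loops: "finite V \<Longrightarrow> pair_pseudo_graph (loops V)"
  by (rule pair_pseudo_graphI) (auto simp: sym_def)

lemma pair_pseudo_graph_loops_with_edge: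
  "finite V \<Longrightarrow> b \<in> V \<Longrightarrow> c \<in> V \<Longrightarrow> pair_pseudo_graph (loops_with_edge V b c)"
  by (rule pair_pseudo_graphI) (auto simp: sym_def)

lemma undirected_subgraphD:
  assumes "undirected_subgraph T G"
  shows "pverts T \<subseteq> pverts G" "parcs T \<subseteq> parcs G"
  using assms by (auto simp: undirected_subgraph_def subgraph_def)

lemma undirected_subgraphI:
  assumes "pair_pseudo_graph T" "pair_pseudo_graph G"
    and "pverts T \<subseteq> pverts G" "parcs T \<subseteq> parcs G"
  shows "undirected_subgraph T G"
proof -
  interpret T: pair_pseudo_graph T by fact
  interpret G: pair_pseudo_graph G by fact
  show ?thesis
    using assms T.wf_digraph_axioms G.wf_digraph_axioms
    by (auto simp: undirected_subgraph_def subgraph_def compatible_def)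
qed

lemma isomorphic_refl: "G \<simeq> G"
  unfolding isomorphic_def graph_iso_def graph_map_def
  by (rule exI[of _ id], intro conjI exI[of _ id]) auto

lemma isomorphic_loops:
  assumes "bij_betw f V W"
  shows "loops V \<simeq> loops W"
  unfolding isomorphic_def graph_iso_def
proof (intro exI conjI)
  show "graph_map (loops V) (loops W) f"
    using assms by (auto simp: graph_map_def bij_betw_def)
  show "graph_map (loops W) (loops V) (inv_into V f)"
    using assms by (auto simp: graph_map_def bij_betw_def inv_into_into)
qed (use assms in \<open>auto simp: bij_betw_def f_inv_into_f\<close>)

lemma stiff_loops: "stiff (loops V)"
  by (auto simp: stiff_def folds_to_def neighbours_def)

lemma stiff_subgraph_of_stiff: "stiff G \<Longrightarrow> stiff_subgraph_of S G \<Longrightarrow> S = G"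
  unfolding stiff_subgraph_of_def
  by (elim conjE, erule converse_rtranclpE) (auto simp: stiff_def fold_step_def)

lemma iso_to_stiff_self: "stiff G \<Longrightarrow> iso_to_stiff G G"
  unfolding iso_to_stiff_def stiff_subgraph_of_def using isomorphic_refl by blast

text \<open>The inverse \<open>g\<close> of an isomorphism from \<open>T\<close> to
  \<open>loops V\<close> is an injective self-map of the finite set \<open>V\<close>, hence onto;
  since it sends loops to loops, \<open>T\<close> already contains every vertex and every
  loop.\<close>

lemma loops_copy_unique:
  assumes "finite V" "undirected_subgraph T (loops V)" "iso_to_stiff T (loops V)"
  shows "T = loops V"
proof -
  have "T \<simeq> loops V"
    using assms(3) stiff_subgraph_of_stiff[OF stiff_loops] by (auto simp: iso_to_stiff_def)
  then obtain f g where g: "graph_map (loops V) T g" and fg: "\<forall>w \<in> V. f (g w) = w"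
    by (auto simp: isomorphic_def graph_iso_def)
  note T = undirected_subgraphD[OF assms(2)]
  have "inj_on g V"
    using fg by (metis inj_on_inverseI)
  moreover have "g ` V \<subseteq> V"
    using g T(1) by (auto simp: graph_map_def)
  ultimately have gV: "g ` V = V"
    using assms(1) by (simp add: endo_inj_surj)
  have "g ` V \<subseteq> pverts T"
    using g by (auto simp: graph_map_def)
  moreover have "\<forall>v \<in> g ` V. (v, v) \<in> parcs T"
    using g by (auto simp: graph_map_def)
  ultimately have "V \<subseteq> pverts T" "Id_on V \<subseteq> parcs T"
    unfolding gV by auto
  then show ?thesis
    using T by (simp add: loops_def pair_pre_digraph.equality subset_antisym)
qed

text \<open>By \<open>loops_copy_unique\<close>, the quantifier over \<open>T\<close> in
  \<open>class_W\<close> reduces to the single case \<open>T = loops V\<close>, and \<open>f\<close>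
  fixes that graph pointwise.\<close>

lemma class_W_loopsI:
  assumes "finite V" "graph_morphism (loops V) B f"
    and "\<And>v. v \<in> V \<Longrightarrow> f v = v" "iso_to_stiff (loops V) B"
  shows "class_W (loops V) B f"
proof -
  have "image_graph f (loops V) = loops V"
    using assms(3) by (force simp: image_graph_def loops_def)
  moreover have "graph_iso (loops V) (loops V) f"
    unfolding graph_iso_def graph_map_def using assms(3) by (auto intro!: exI[of _ id])
  ultimately show ?thesis
    using assms(1,2,4) by (auto simp: class_W_def dest: loops_copy_unique)
qed

lemma stiff_subgraph_of_loops_with_edge:
  assumes "b \<in> V" "c \<notin> V"
  shows "stiff_subgraph_of (loops V) (loops_with_edge (insert c V) b c)"
proof -
  let ?C = "loops_with_edge (insert c V) b c"
  \<comment> \<open>Both \<open>b\<close> and \<open>c\<close> have neighbourhood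
    \<open>{b, c}\<close>.\<close>
  have "folds_to ?C c b"
    using assms by (auto simp: folds_to_def neighbours_def)
  moreover have "loops V = delete_vertex ?C c"
    using assms by (auto simp: delete_vertex_def loops_def)
  ultimately have "fold_step ?C (loops V)"
    by (auto simp: fold_step_def)
  then show ?thesis
    by (auto simp: stiff_subgraph_of_def stiff_loops)
qed

theorem proposition4p2:
  assumes "infinite (UNIV :: 'a set)"
  shows "\<not> two_out_of_six (class_W :: 'a morphism_class)"
proof
  assume W: "two_out_of_six (class_W :: 'a morphism_class)"
  \<comment> \<open>Infinitude of the vertex type supplies three distinct vertices.\<close>
  obtain X :: "'a set" where "card X = 3"
    using infinite_arbitrarily_large[OF assms] by blast
  then obtain a b c :: 'a where abc: "a \<noteq> b" "b \<noteq> c" "a \<noteq> c"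
    by (auto simp: card_3_iff)
  define S where "S = loops {a, b}"
  define C where "C = loops_with_edge (insert c {a, b}) b c"
  define h where "h = id(c := b)"
  have graphs: "pair_pseudo_graph S" "pair_pseudo_graph C"
    by (auto simp: S_def C_def intro!: pair_pseudo_graph_loops pair_pseudo_graph_loops_with_edge)
  have mors: "graph_morphism S S id" "graph_morphism S C id" "graph_morphism C S h"
    "graph_morphism S S h"
    using graphs abc by (auto simp: graph_morphism_def graph_map_def S_def C_def h_def)
  have C_folds: "stiff_subgraph_of S C"
    unfolding S_def C_def by (rule stiff_subgraph_of_loops_with_edge) (use abc in auto)
  have "class_W S C id"
    using mors C_folds unfolding S_def
    by (intro class_W_loopsI) (auto simp: iso_to_stiff_def intro: isomorphic_refl)
  \<comment> \<open>Since \<open>h\<close> moves only \<open>c\<close>, it acts as the identity on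
    \<open>S\<close>; this is the composite of the inclusion with the fold map.\<close>
  moreover have "class_W S S h"
    using mors abc unfolding S_def
    by (intro class_W_loopsI iso_to_stiff_self stiff_loops) (auto simp: h_def)
  ultimately have "class_W C S h"
    \<comment> \<open>The variables are instantiated in order of first occurrence: \<open>A\<close>,
      \<open>B\<close>, \<open>f\<close>, \<open>C\<close>, \<open>g\<close>, \<open>D\<close>,
      \<open>h\<close>.\<close>
    using W[unfolded two_out_of_six_def, rule_format, of S S id C id S h] mors by simp
  moreover have "undirected_subgraph (loops {b, c}) C"
    using graphs by (intro undirected_subgraphI pair_pseudo_graph_loops) (auto simp: C_def)
  moreover have "loops {b, c} \<simeq> S"
    unfolding S_def using abc
    by (intro isomorphic_loops[of "id(c := a)"]) (auto simp: bij_betw_def)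
  ultimately have "graph_iso (loops {b, c}) (image_graph h (loops {b, c})) h"
    using C_folds by (auto simp: class_W_def iso_to_stiff_def)
  \<comment> \<open>As \<open>h b = h c = b\<close>, an inverse \<open>k\<close> would have to send
    \<open>b\<close> to both \<open>b\<close> and \<open>c\<close>.\<close>
  then obtain k where "k (h b) = b" "k (h c) = c"
    by (auto simp: graph_iso_def)
  then show False
    using abc by (simp add: h_def)
qed

end
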